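(* The decoupled (single-cell) problem is indexable: for all $\epsilon_1,\epsilon_2\in\mathbb R$ with $\epsilon_1<\epsilon_2$, the passive sets satisfy $\mathcal D(\epsilon_2)\subseteq\mathcal D(\epsilon_1)$, i.e. the passive set $\mathcal D(\epsilon)$ is monotonically non-increasing as $\epsilon$ increases.
   Context: Single-cell model. A base station is ON ($1$) or OFF ($0$) in each time segment of duration $T_s>0$. Constants: $\mathcal P_{\rm static}\ge0$, $\mathcal P_{\rm switch}\ge0$, $\mathcal P_e>\mathcal P_d\ge 0$; rates $\lambda_1,\dots,\lambda_J>0$, a probability vector $(p_1,\dots,p_J)$, $\mu>0$, and $\overline\lambda=\sum_jp_j\lambda_j$. A state is $s=(b,\widetilde n)$, where $b\in\{0,1\}$ is the status in the previous segment and $\widetilde n\in\mathbb N$ the number of users. The action $a\in\{0,1\}$ is the status in the current segment; the next state is $(a,\widetilde n')$ with $\widetilde n'$ independent of $(s,a)$ and of law $$\Pr(\widetilde n=k)=\sum_{j=1}^Jp_j\frac{\widetilde\lambda_j^{k}}{k!}e^{-\widetilde\lambda_j},\quad\widetilde\lambda_j=\frac{\lambda_j}{\mu}(1-e^{-\mu T_s}),\ k=0,1,2,\dots$$ Let $f:[0,\infty)\to\mathbb R$ be non-decreasing. For a parameter $\epsilon\in\mathbb R$ (an extra cost of being OFF), the immediate cost is $$c_\epsilon\big((b,\widetilde n),a\big)=\begin{cases}f[\mathcal P_{\rm static}+(\widetilde n+\overline\lambda T_s)\mathcal P_d],&a=b=1,\\ f[\mathcal P_{\rm static}+\mathcal P_{\rm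 switch}+(\widetilde n+\overline\lambda T_s)\mathcal P_d],&a=1,\ b=0,\\ f[(\widetilde n+\overline\lambda T_s)\mathcal P_e]+\epsilon,&a=0.\end{cases}$$ The decoupled problem is to minimize the long-term average cost $\lim_{T\to\infty}\mathbb E[\frac1T\sum_{t=0}^{T-1}c_\epsilon(s^t,a^t)]$. Optimality. For each $\epsilon$ let $(g_\epsilon,h_\epsilon)$ be a solution of the average-cost Bellman equation $$g_\epsilon+h_\epsilon[s]=\min\{Q_\epsilon(s,1),Q_\epsilon(s,0)\}\ \text{ for all }s,\qquad Q_\epsilon(s,a)=c_\epsilon(s,a)+\Sigma_a,$$ $$\Sigma_a=\sum_{k=0}^\infty\Pr(\widetilde n=k)\,h_\epsilon[(a,k)],$$ normalized by $h_\epsilon[(1,0)]=0$; it is assumed that such solutions exist and that all these sums (and the expectations of $f$ of the powers above) are finite. The optimal action in state $s$ is ON if $Q_\epsilon(s,1)<Q_\epsilon(s,0)$ and OFF otherwise. Passive set. $\mathcal D(\epsilon)$ is the set of all states $s$ in which the optimal action is OFF, i.e. $\mathcal D(\epsilon)=\{s:\ Q_\epsilon(s,0)\le Q_\epsilon(s,1)\}$. *)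

theory Defs
  imports Complex_Main
begin

datatype status = Off | On

text \<open>A state is the status in the previous segment together with the number of users.\<close>

type_synonym state = "status \<times> nat"

record cell =
  seg_len :: real        (* \<open>T\<^sub>s\<close> *)
  P_static :: real
  P_switch :: real
  P_e :: real
  P_d :: real
  num_rates :: nat       (* \<open>J\<close>; the rates are indexed by \<open>{1..J}\<close> *)
  rate :: "nat \<Rightarrow> real"   (* \<open>\<lambda>\<^sub>j\<close> *)
  wt :: "nat \<Rightarrow> real"     (* \<open>p\<^sub>j\<close> *)
  mu :: real
  cost_fun :: "real \<Rightarrow> real"  (* \<open>f\<close>; only its values on \<open>{0..}\<close> are relevant *)

definition valid_cell :: "cell \<Rightarrow> bool" where
  "valid_cell M \<longleftrightarrow>
     seg_len M > 0 \<and> P_static M \<ge> 0 \<and> P_switch M \<ge> 0 \<and>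
     P_d M \<ge> 0 \<and> P_e M > P_d M \<and> mu M > 0 \<and>
     (\<forall>j\<in>{1..num_rates M}. rate M j > 0) \<and>
     (\<forall>j\<in>{1..num_rates M}. wt M j \<ge> 0) \<and>
     (\<Sum>j\<in>{1..num_rates M}. wt M j) = 1 \<and>
     mono_on {0..} (cost_fun M)"

definition mean_rate :: "cell \<Rightarrow> real" where
  "mean_rate M = (\<Sum>j\<in>{1..num_rates M}. wt M j * rate M j)"

definition eff_rate :: "cell \<Rightarrow> nat \<Rightarrow> real" where
  "eff_rate M j = rate M j / mu M * (1 - exp (- mu M * seg_len M))"

definition user_prob :: "cell \<Rightarrow> nat \<Rightarrow> real" where
  "user_prob M k =
     (\<Sum>j\<in>{1..num_rates M}. wt M j * (eff_rate M j ^ k / fact k * exp (- eff_rate M j)))"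

fun consumed_power :: "cell \<Rightarrow> state \<Rightarrow> status \<Rightarrow> real" where
  "consumed_power M (On, n) On = P_static M + (real n + mean_rate M * seg_len M) * P_d M"
| "consumed_power M (Off, n) On =
     P_static M + P_switch M + (real n + mean_rate M * seg_len M) * P_d M"
| "consumed_power M (b, n) Off = (real n + mean_rate M * seg_len M) * P_e M"

definition cost :: "cell \<Rightarrow> real \<Rightarrow> state \<Rightarrow> status \<Rightarrow> real" where
  "cost M \<epsilon> s a = cost_fun M (consumed_power M s a) + (if a = Off then \<epsilon> else 0)"

definition finite_expected_cost :: "cell \<Rightarrow> bool" where
  "finite_expected_cost M \<longleftrightarrow>
     (\<forall>b a. summable (\<lambda>k. user_prob M k * cost_fun M (consumed_power M (b, k) a)))"

text \<open>The next state is \<open>(a, n')\<close> with \<open>n'\<close> distributed according to \<^const>\<open>user_prob\<close>,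
  independently of the current state and of \<open>a\<close>.\<close>

definition expected_next :: "cell \<Rightarrow> (state \<Rightarrow> real) \<Rightarrow> status \<Rightarrow> real" where
  "expected_next M h a = (\<Sum>k. user_prob M k * h (a, k))"

definition Q :: "cell \<Rightarrow> real \<Rightarrow> (state \<Rightarrow> real) \<Rightarrow> state \<Rightarrow> status \<Rightarrow> real" where
  "Q M \<epsilon> h s a = cost M \<epsilon> s a + expected_next M h a"

definition bellman_solution :: "cell \<Rightarrow> real \<Rightarrow> real \<Rightarrow> (state \<Rightarrow> real) \<Rightarrow> bool" where
  "bellman_solution M \<epsilon> g h \<longleftrightarrow>
     (\<forall>a. summable (\<lambda>k. user_prob M k * h (a, k))) \<and>
     (\<forall>s. g + h s = min (Q M \<epsilon> h s On) (Q M \<epsilon> h s Off)) \<and>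
     h (On, 0) = 0"

definition optimal_action :: "cell \<Rightarrow> real \<Rightarrow> (state \<Rightarrow> real) \<Rightarrow> state \<Rightarrow> status" where
  "optimal_action M \<epsilon> h s = (if Q M \<epsilon> h s On < Q M \<epsilon> h s Off then On else Off)"

definition passive_set :: "cell \<Rightarrow> real \<Rightarrow> (state \<Rightarrow> real) \<Rightarrow> state set" where
  "passive_set M \<epsilon> h = {s. optimal_action M \<epsilon> h s = Off}"

lemma passive_set_eq: "passive_set M \<epsilon> h = {s. Q M \<epsilon> h s Off \<le> Q M \<epsilon> h s On}"
  by (auto simp: passive_set_def optimal_action_def)

definition indexable :: "(real \<Rightarrow> state set) \<Rightarrow> bool" where
  "indexable D \<longleftrightarrow> (\<forall>\<epsilon>\<^sub>1 \<epsilon>\<^sub>2. \<epsilon>\<^sub>1 < \<epsilon>\<^sub>2 \<longrightarrow> D \<epsilon>\<^sub>2 \<subseteq> D \<epsilon>\<^sub>1)"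

end

(* The optimal action in a state is OFF iff the threshold theta = epsilon + Sigma_0 - Sigma_1 is at
   most the difference of the immediate costs of ON and OFF (without epsilon), so it suffices that
   theta increases with epsilon. The Bellman equation gives
   h(1,k) - h(0,k) = min (A k) (B k + theta) - min (A' k) (B k + theta), where A, A', B do not
   depend on epsilon. This is a 1-Lipschitz function of theta, hence so is its expectation
   Sigma_1 - Sigma_0 = epsilon - theta. If theta did not increase from epsilon_1 to epsilon_2, this
   would give epsilon_2 - epsilon_1 <= 0. *)

theory Submission
  imports Defs
begin

lemma eff_rate_nonneg:
  assumes "valid_cell M" and "j \<in> {1..num_rates M}"
  shows "eff_rate M j \<ge> 0"
  using assms unfolding valid_cell_def eff_rate_def
  by (intro mult_nonneg_nonneg divide_nonneg_nonneg) (auto simp: less_imp_le)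

lemma user_prob_nonneg:
  assumes "valid_cell M"
  shows "user_prob M k \<ge> 0"
proof -
  have "wt M j \<ge> 0" if "j \<in> {1..num_rates M}" for j
    using assms that by (auto simp: valid_cell_def)
  then show ?thesis
    unfolding user_prob_def using eff_rate_nonneg[OF assms]
    by (intro sum_nonneg mult_nonneg_nonneg divide_nonneg_nonneg zero_le_power) auto
qed

text \<open>A mixture of Poisson laws, each of mass 1 by the exponential series. Total mass 1 lets a
  constant bound that holds for every k pass unchanged to the expectation.\<close>

lemma user_prob_sums_1:
  assumes "valid_cell M"
  shows "user_prob M sums 1"
proof -
  have "(\<lambda>k. x ^ k / fact k * exp (- x)) sums 1" for x :: real
    using sums_mult2[OF exp_converges[of x], of "exp (- x)"]
    by (simp add: exp_minus divide_inverse mult_ac)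
  then have "(\<lambda>k. wt M j * (eff_rate M j ^ k / fact k * exp (- eff_rate M j))) sums wt M j" for j
    using sums_mult by fastforce
  then have "user_prob M sums (\<Sum>j\<in>{1..num_rates M}. wt M j)"
    unfolding user_prob_def by (rule sums_sum)
  then show ?thesis
    using assms by (simp add: valid_cell_def)
qed

definition off_threshold :: "cell \<Rightarrow> real \<Rightarrow> (state \<Rightarrow> real) \<Rightarrow> real" where
  "off_threshold M \<epsilon> h = \<epsilon> + expected_next M h Off - expected_next M h On"

lemma mem_passive_set_iff:
  "s \<in> passive_set M \<epsilon> h \<longleftrightarrow>
     off_threshold M \<epsilon> h \<le> cost_fun M (consumed_power M s On) - cost_fun M (consumed_power M s Off)"
  by (auto simp: passive_set_eq Q_def cost_def off_threshold_def)

text \<open>Subtracting the Bellman equations at the two states cancels \<open>g\<close>, and taking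
  \<open>expected_next M h On\<close> out of both minima leaves the threshold in the OFF branch. The
  power consumed when OFF ignores the previous status, so \<open>(On, k)\<close> can stand in both
  OFF branches.\<close>

lemma bellman_solution_diff:
  assumes "bellman_solution M \<epsilon> g h"
  shows "h (On, k) - h (Off, k) =
    min (cost_fun M (consumed_power M (On, k) On))
        (cost_fun M (consumed_power M (On, k) Off) + off_threshold M \<epsilon> h) -
    min (cost_fun M (consumed_power M (Off, k) On))
        (cost_fun M (consumed_power M (On, k) Off) + off_threshold M \<epsilon> h)"
proof -
  have "g + h s = min (Q M \<epsilon> h s On) (Q M \<epsilon> h s Off)" for s
    using assms unfolding bellman_solution_def by blast
  from this[of "(On, k)"] this[of "(Off, k)"] show ?thesis
    by (simp add: Q_def cost_def off_threshold_def min_def split: if_splits)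
qed

lemma off_threshold_strict_mono:
  assumes valid: "valid_cell M"
    and sol1: "bellman_solution M \<epsilon>\<^sub>1 g\<^sub>1 h\<^sub>1"
    and sol2: "bellman_solution M \<epsilon>\<^sub>2 g\<^sub>2 h\<^sub>2"
    and less: "\<epsilon>\<^sub>1 < \<epsilon>\<^sub>2"
  shows "off_threshold M \<epsilon>\<^sub>1 h\<^sub>1 < off_threshold M \<epsilon>\<^sub>2 h\<^sub>2"
proof (rule ccontr)
  let ?\<theta>1 = "off_threshold M \<epsilon>\<^sub>1 h\<^sub>1" and ?\<theta>2 = "off_threshold M \<epsilon>\<^sub>2 h\<^sub>2"
  assume "\<not> ?\<theta>1 < ?\<theta>2"
  then have le: "?\<theta>2 \<le> ?\<theta>1" by simp
  have diff_sums: "(\<lambda>k. user_prob M k * (h (On, k) - h (Off, k)))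
      sums (expected_next M h On - expected_next M h Off)"
    if "bellman_solution M \<epsilon> g h" for \<epsilon> g h
  proof -
    have "(\<lambda>k. user_prob M k * h (a, k)) sums expected_next M h a" for a
      using that by (simp add: bellman_solution_def expected_next_def summable_sums)
    then show ?thesis
      by (simp add: right_diff_distrib sums_diff)
  qed
  \<comment> \<open>As the threshold drops from \<open>?\<theta>1\<close> to
    \<open>?\<theta>2\<close>, the first minimum cannot grow and the subtracted one falls by at most
    the size of the drop.\<close>
  have "(h\<^sub>2 (On, k) - h\<^sub>2 (Off, k)) - (h\<^sub>1 (On, k) - h\<^sub>1 (Off, k)) \<le> ?\<theta>1 - ?\<theta>2" for k
    unfolding bellman_solution_diff[OF sol1] bellman_solution_diff[OF sol2]
    using le by (simp add: min_def)
  then have "user_prob M k * (h\<^sub>2 (On, k) - h\<^sub>2 (Off, k)) - user_prob M k * (h\<^sub>1 (On, k) - h\<^sub>1 (Off, k))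
      \<le> user_prob M k * (?\<theta>1 - ?\<theta>2)" for k
    unfolding right_diff_distrib[symmetric]
    by (rule mult_left_mono) (rule user_prob_nonneg[OF valid])
  from sums_le[OF this sums_diff[OF diff_sums[OF sol2] diff_sums[OF sol1]]
      sums_mult2[OF user_prob_sums_1[OF valid]]]
  have "(expected_next M h\<^sub>2 On - expected_next M h\<^sub>2 Off) -
      (expected_next M h\<^sub>1 On - expected_next M h\<^sub>1 Off) \<le> ?\<theta>1 - ?\<theta>2"
    by simp
  \<comment> \<open>Each difference of expectations is \<epsilon> minus its threshold; the
    thresholds cancel and \<open>\<epsilon>\<^sub>2 \<le> \<epsilon>\<^sub>1\<close>
    remains.\<close>
  with less show False
    by (simp add: off_threshold_def)
qed

theorem theorem8:
  fixes M :: cell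
    and g :: "real \<Rightarrow> real"
    and h :: "real \<Rightarrow> state \<Rightarrow> real"
  assumes "valid_cell M"
    and "finite_expected_cost M"
    and "\<And>\<epsilon>. bellman_solution M \<epsilon> (g \<epsilon>) (h \<epsilon>)"
  shows "indexable (\<lambda>\<epsilon>. passive_set M \<epsilon> (h \<epsilon>))"
  unfolding indexable_def
  using off_threshold_strict_mono[OF assms(1) assms(3) assms(3)]
  by (fastforce simp: mem_passive_set_iff)

end
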